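(* For each integer $s\ge1$ there is a $PSU(1,1)$-equivariant cross-section of the projection $\mathcal P_s:S^s\big(H^{-1}(\Delta)\big)\to H^{-s}(\Delta)$; that is, there is a $PSU(1,1)$-equivariant linear map $\sigma_s:H^{-s}(\Delta)\to S^s\big(H^{-1}(\Delta)\big)$ with $\mathcal P_s\circ\sigma_s=\mathrm{id}$.
   Context: $\Delta$ is the open unit disk. $PSU(1,1)=\left\{\pm\begin{pmatrix}a&b\\ \bar b&\bar a\end{pmatrix}:|a|^2-|b|^2=1\right\}$. For an integer $m$, $H^m(\Delta)$ is the space of holomorphic differentials $f(z)(dz)^m$ of degree $m$ on $\Delta$ ($f$ holomorphic on $\Delta$), with action $$g:f(z)(dz)^m\mapsto f\left(\frac{-\bar b+az}{\bar a-bz}\right)(\bar a-bz)^{-2m}(dz)^m .$$ We write $(dz)^{-1}=\frac{\partial}{\partial z}$, so $H^{-1}(\Delta)$ is the space of holomorphic vector fields $f(z)\frac{\partial}{\partial z}$ on $\Delta$ and $H^{-s}(\Delta)$ consists of $f(z)\left(\frac{\partial}{\partial z}\right)^s$. $S^s(H^{-1}(\Delta))$ is the space of symmetric tensors of order $s$ inside the $s$-fold tensor power of $H^{-1}(\Delta)$ over $\mathbb C$, with the diagonal group action; it is spanned by the monomials $$\bigodot_{i=1}^sf_i(z)\tfrac{\partial}{\partial z}=\frac1{s!}\sum_{\sigma\in S_s}f_{\sigma(1)}(z)\tfrac{\partial}{\partial z}\otimes\cdots\otimes f_{\sigma(s)}(z)\tfrac{\partial}{\partial z},$$ where $S_s$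 is the symmetric group on $s$ letters. The projection $\mathcal P_s$ is the equivariant linear map determined by $$\mathcal P_s:\bigodot_{i=1}^sf_i(z)\tfrac{\partial}{\partial z}\mapsto\prod_{i=1}^sf_i(z)\left(\tfrac{\partial}{\partial z}\right)^s .$$ *)

theory Defs
  imports "HOL-Complex_Analysis.Complex_Analysis" "HOL-Library.Poly_Mapping"
    "HOL-Combinatorics.Permutations"
begin

no_notation fps_nth (infixl \<open>$\<close> 75)

section \<open>Complex vector spaces\<close>

class complex_vector = ab_group_add +
  fixes scaleC :: "complex \<Rightarrow> 'a \<Rightarrow> 'a" (infixr \<open>*\<^sub>C\<close> 75)
  assumes scaleC_add_right: "c *\<^sub>C (x + y) = c *\<^sub>C x + c *\<^sub>C y"
    and scaleC_add_left: "(c + d) *\<^sub>C x = c *\<^sub>C x + d *\<^sub>C x"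
    and scaleC_scaleC: "c *\<^sub>C (d *\<^sub>C x) = (c * d) *\<^sub>C x"
    and scaleC_one: "1 *\<^sub>C x = x"

global_interpretation cvs: vector_space "scaleC :: complex \<Rightarrow> 'a \<Rightarrow> 'a::complex_vector"
  by unfold_locales (simp_all add: scaleC_add_right scaleC_add_left scaleC_scaleC scaleC_one)

abbreviation clinear :: "('a::complex_vector \<Rightarrow> 'b::complex_vector) \<Rightarrow> bool"
  where "clinear \<equiv> Vector_Spaces.linear scaleC scaleC"

abbreviation cspan :: "'a::complex_vector set \<Rightarrow> 'a set"
  where "cspan \<equiv> cvs.span"

lemma clinearI:
  assumes "\<And>x y. f (x + y) = f x + f y" "\<And>c x. f (c *\<^sub>C x) = c *\<^sub>C f x"
  shows "clinear f"
  by unfold_locales (simp_all add: assms)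

lemma clinear_add: "clinear f \<Longrightarrow> f (x + y) = f x + f y"
  by (simp add: Vector_Spaces.linear_def module_hom_def module_hom_axioms_def)

lemma clinear_scale: "clinear f \<Longrightarrow> f (c *\<^sub>C x) = c *\<^sub>C f x"
  by (simp add: Vector_Spaces.linear_def module_hom_def module_hom_axioms_def)

lemma clinear_zero: "clinear f \<Longrightarrow> f 0 = 0"
  using clinear_scale[of f 0 0] by simp

lemma clinear_diff: "clinear f \<Longrightarrow> f (x - y) = f x - f y"
  using clinear_add[of f "x - y" y] by simp

lemma clinear_sum: "clinear f \<Longrightarrow> f (sum g A) = (\<Sum>x\<in>A. f (g x))"
  by (induct A rule: infinite_finite_induct) (simp_all add: clinear_zero clinear_add)

instantiation complex :: complex_vector
begin
definition scaleC_complex :: "complex \<Rightarrow> complex \<Rightarrow> complex"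
  where "scaleC_complex = (*)"
instance by standard (simp_all add: scaleC_complex_def algebra_simps)
end

instantiation poly_mapping :: (type, complex_vector) complex_vector
begin
definition scaleC_poly_mapping :: "complex \<Rightarrow> ('a \<Rightarrow>\<^sub>0 'b) \<Rightarrow> 'a \<Rightarrow>\<^sub>0 'b"
  where "scaleC_poly_mapping c = Poly_Mapping.map (scaleC c)"

lemma lookup_scaleC: "Poly_Mapping.lookup (c *\<^sub>C u) k = c *\<^sub>C Poly_Mapping.lookup u k"
  by (simp add: scaleC_poly_mapping_def Poly_Mapping.map.rep_eq when_def)

instance
  by standard (rule poly_mapping_eqI,
    simp add: lookup_scaleC lookup_add scaleC_add_right scaleC_add_left scaleC_scaleC scaleC_one)+
end


section \<open>Tensor powers\<close>

text \<open>The tensor algebra of \<open>V\<close>: formal linear combinations of finite words over \<open>V\<close>,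
  modulo the relations making every letter of a word linear. The relations are
  homogeneous in the length of words, so the image of the words of length \<open>s\<close> spans
  the \<open>s\<close>-fold tensor power of \<open>V\<close>.\<close>

definition tensor_relators :: "('a::complex_vector list \<Rightarrow>\<^sub>0 complex) set"
  where "tensor_relators =
    {Poly_Mapping.single (xs @ (x + y) # ys) 1
       - Poly_Mapping.single (xs @ x # ys) 1 - Poly_Mapping.single (xs @ y # ys) 1
     | xs x y ys. True} \<union>
    {Poly_Mapping.single (xs @ (c *\<^sub>C x) # ys) 1 - c *\<^sub>C Poly_Mapping.single (xs @ x # ys) 1
     | xs c x ys. True}"

definition tensor_rel ::
    "('a::complex_vector list \<Rightarrow>\<^sub>0 complex) \<Rightarrow> ('a list \<Rightarrow>\<^sub>0 complex) \<Rightarrow> bool"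
  where "tensor_rel u v \<longleftrightarrow> u - v \<in> cspan tensor_relators"

lemma equivp_tensor_rel: "equivp (tensor_rel :: ('a::complex_vector list \<Rightarrow>\<^sub>0 complex) \<Rightarrow> _)"
proof (rule equivpI)
  show "reflp (tensor_rel :: ('a list \<Rightarrow>\<^sub>0 complex) \<Rightarrow> _)"
    by (simp add: reflp_def tensor_rel_def cvs.span_zero)
  show "symp (tensor_rel :: ('a list \<Rightarrow>\<^sub>0 complex) \<Rightarrow> _)"
    unfolding symp_def tensor_rel_def by (metis cvs.span_neg minus_diff_eq)
  show "transp (tensor_rel :: ('a list \<Rightarrow>\<^sub>0 complex) \<Rightarrow> _)"
  proof (rule transpI)
    fix u v w :: "'a list \<Rightarrow>\<^sub>0 complex"
    assume "tensor_rel u v" "tensor_rel v w"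
    then have "(u - v) + (v - w) \<in> cspan tensor_relators"
      unfolding tensor_rel_def by (rule cvs.span_add)
    then show "tensor_rel u w" by (simp add: tensor_rel_def)
  qed
qed

quotient_type (overloaded) 'a tensor = "'a::complex_vector list \<Rightarrow>\<^sub>0 complex" / tensor_rel
  by (rule equivp_tensor_rel)

instantiation tensor :: (complex_vector) complex_vector
begin

lift_definition zero_tensor :: "'a tensor" is 0 .

lift_definition plus_tensor :: "'a tensor \<Rightarrow> 'a tensor \<Rightarrow> 'a tensor" is "(+)"
  unfolding tensor_rel_def add_diff_add by (rule cvs.span_add)

lift_definition uminus_tensor :: "'a tensor \<Rightarrow> 'a tensor" is uminus
  unfolding tensor_rel_def minus_diff_minus by (rule cvs.span_neg)

lift_definition minus_tensor :: "'a tensor \<Rightarrow> 'a tensor \<Rightarrow> 'a tensor" is "(-)"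
proof -
  fix u v u' v' :: "'a list \<Rightarrow>\<^sub>0 complex"
  assume "tensor_rel u v" "tensor_rel u' v'"
  moreover have "u - u' - (v - v') = (u - v) - (u' - v')" by simp
  ultimately show "tensor_rel (u - u') (v - v')"
    unfolding tensor_rel_def by (simp only: cvs.span_diff)
qed

lift_definition scaleC_tensor :: "complex \<Rightarrow> 'a tensor \<Rightarrow> 'a tensor" is scaleC
  unfolding tensor_rel_def cvs.scale_right_diff_distrib[symmetric] by (rule cvs.span_scale)

instance
proof
  fix a b c :: "'a tensor" and k l :: complex
  have R: "tensor_rel u u" for u :: "'a list \<Rightarrow>\<^sub>0 complex"
    by (simp add: tensor_rel_def cvs.span_zero)
  show "a + b + c = a + (b + c)" by transfer (simp add: R add.assoc)
  show "a + b = b + a" by transfer (simp add: R add.commute)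
  show "0 + a = a" by transfer (simp add: R)
  show "- a + a = 0" by transfer (simp add: R)
  show "a - b = a + - b" by transfer (simp add: R)
  show "k *\<^sub>C (a + b) = k *\<^sub>C a + k *\<^sub>C b" by transfer (simp add: R scaleC_add_right)
  show "(k + l) *\<^sub>C a = k *\<^sub>C a + l *\<^sub>C a" by transfer (simp add: R scaleC_add_left)
  show "k *\<^sub>C (l *\<^sub>C a) = (k * l) *\<^sub>C a" by transfer (simp add: R scaleC_scaleC)
  show "1 *\<^sub>C a = a" by transfer (simp add: R scaleC_one)
qed

end

text \<open>\<open>pure_tensor [x\<^sub>1, \<dots>, x\<^sub>s]\<close> is \<open>x\<^sub>1 \<otimes> \<dots> \<otimes> x\<^sub>s\<close>.\<close>

lift_definition pure_tensor :: "'a::complex_vector list \<Rightarrow> 'a tensor"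
  is "\<lambda>xs. Poly_Mapping.single xs 1" .

definition tensor_power :: "nat \<Rightarrow> 'a::complex_vector tensor set"
  where "tensor_power s = cspan {pure_tensor xs | xs. length xs = s}"

definition multilinear :: "('a::complex_vector list \<Rightarrow> 'b::complex_vector) \<Rightarrow> bool"
  where "multilinear \<phi> \<longleftrightarrow>
    (\<forall>xs x y ys. \<phi> (xs @ (x + y) # ys) = \<phi> (xs @ x # ys) + \<phi> (xs @ y # ys)) \<and>
    (\<forall>xs c x ys. \<phi> (xs @ (c *\<^sub>C x) # ys) = c *\<^sub>C \<phi> (xs @ x # ys))"

lemma multilinearD:
  assumes "multilinear \<phi>"
  shows "\<phi> (xs @ (x + y) # ys) = \<phi> (xs @ x # ys) + \<phi> (xs @ y # ys)"
    and "\<phi> (xs @ (c *\<^sub>C x) # ys) = c *\<^sub>C \<phi> (xs @ x # ys)"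
  using assms unfolding multilinear_def by blast+

lemma multilinear_pure_tensor: "multilinear pure_tensor"
  unfolding multilinear_def
proof (intro conjI allI)
  fix xs ys :: "'a list" and x y :: 'a and c :: complex
  show "pure_tensor (xs @ (x + y) # ys) = pure_tensor (xs @ x # ys) + pure_tensor (xs @ y # ys)"
    by transfer
      (unfold tensor_rel_def diff_diff_eq[symmetric] tensor_relators_def,
        rule cvs.span_base, rule UnI1, blast)
  show "pure_tensor (xs @ (c *\<^sub>C x) # ys) = c *\<^sub>C pure_tensor (xs @ x # ys)"
    by transfer
      (unfold tensor_rel_def tensor_relators_def, rule cvs.span_base, rule UnI2, blast)
qed

text \<open>For multilinear \<open>\<phi>\<close>, \<open>tensor_lift \<phi>\<close> is the linear map induced by \<open>\<phi>\<close>: by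
  \<open>tensor_lift_abs\<close> below it does not depend on the representative chosen here.
  It is unspecified for other \<open>\<phi>\<close>.\<close>

definition free_lift :: "('a \<Rightarrow> 'b::complex_vector) \<Rightarrow> ('a \<Rightarrow>\<^sub>0 complex) \<Rightarrow> 'b"
  where "free_lift \<phi> u =
    (\<Sum>xs\<in>Poly_Mapping.keys u. Poly_Mapping.lookup u xs *\<^sub>C \<phi> xs)"

definition tensor_lift :: "('a::complex_vector list \<Rightarrow> 'b::complex_vector) \<Rightarrow> 'a tensor \<Rightarrow> 'b"
  where "tensor_lift \<phi> t = free_lift \<phi> (rep_tensor t)"

lemma free_lift_superset:
  assumes "finite A" "Poly_Mapping.keys u \<subseteq> A"
  shows "free_lift \<phi> u = (\<Sum>xs\<in>A. Poly_Mapping.lookup u xs *\<^sub>C \<phi> xs)"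
  unfolding free_lift_def
  by (rule sum.mono_neutral_left) (use assms in \<open>auto simp: in_keys_iff\<close>)

lemma clinear_free_lift: "clinear (free_lift \<phi>)"
proof (rule clinearI)
  fix u v :: "'a \<Rightarrow>\<^sub>0 complex" and c :: complex
  let ?A = "Poly_Mapping.keys u \<union> Poly_Mapping.keys v"
  have A: "finite ?A" "Poly_Mapping.keys (u + v) \<subseteq> ?A"
    by (auto simp: finite_keys dest: subsetD[OF Poly_Mapping.keys_add])
  show "free_lift \<phi> (u + v) = free_lift \<phi> u + free_lift \<phi> v"
    by (simp add: free_lift_superset[OF A] free_lift_superset[OF A(1), of u]
        free_lift_superset[OF A(1), of v] lookup_add scaleC_add_left sum.distrib)
  have K: "Poly_Mapping.keys (c *\<^sub>C u) \<subseteq> Poly_Mapping.keys u"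
    by (auto simp: in_keys_iff lookup_scaleC)
  show "free_lift \<phi> (c *\<^sub>C u) = c *\<^sub>C free_lift \<phi> u"
    unfolding free_lift_superset[OF finite_keys K]
    by (simp add: free_lift_def lookup_scaleC cvs.scale_sum_right scaleC_complex_def)
qed

lemma free_lift_single [simp]: "free_lift \<phi> (Poly_Mapping.single k 1) = \<phi> k"
  by (simp add: free_lift_def scaleC_one)

lemma free_lift_tensor_rel:
  assumes "multilinear \<phi>" "tensor_rel u v"
  shows "free_lift \<phi> u = free_lift \<phi> v"
proof -
  note L = clinear_free_lift[of \<phi>]
  have "free_lift \<phi> w = 0" if "w \<in> cspan tensor_relators" for w
    using that
  proof (induct rule: cvs.span_induct_alt)
    case base
    show ?case by (rule clinear_zero[OF L])
  next
    case (step c x y)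
    have "free_lift \<phi> x = 0"
      using step(1) assms(1)
      by (auto simp: tensor_relators_def multilinear_def clinear_diff[OF L] clinear_scale[OF L])
    with step show ?case by (simp add: clinear_add[OF L] clinear_scale[OF L])
  qed
  from this[of "u - v"] show ?thesis
    using assms(2) by (simp add: tensor_rel_def clinear_diff[OF L])
qed

lemma tensor_lift_abs:
  assumes "multilinear \<phi>"
  shows "tensor_lift \<phi> (abs_tensor u) = free_lift \<phi> u"
proof -
  have "tensor_rel (rep_tensor (abs_tensor u)) u"
    by (rule Quotient_rep_abs[OF Quotient_tensor]) (simp add: tensor_rel_def cvs.span_zero)
  then show ?thesis
    unfolding tensor_lift_def by (rule free_lift_tensor_rel[OF assms])
qed

lemma tensor_lift_pure:
  "multilinear \<phi> \<Longrightarrow> tensor_lift \<phi> (pure_tensor xs) = \<phi> xs"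
  by (simp add: pure_tensor.abs_eq tensor_lift_abs)

lemma clinear_tensor_lift:
  assumes "multilinear \<phi>"
  shows "clinear (tensor_lift \<phi>)"
proof (rule clinearI)
  fix x y :: "'a tensor" and c :: complex
  show "tensor_lift \<phi> (x + y) = tensor_lift \<phi> x + tensor_lift \<phi> y"
    by (induct x, induct y)
      (simp add: plus_tensor.abs_eq tensor_lift_abs[OF assms] clinear_add[OF clinear_free_lift])
  show "tensor_lift \<phi> (c *\<^sub>C x) = c *\<^sub>C tensor_lift \<phi> x"
    by (induct x)
      (simp add: scaleC_tensor.abs_eq tensor_lift_abs[OF assms] clinear_scale[OF clinear_free_lift])
qed

definition tensor_map :: "('a::complex_vector \<Rightarrow> 'b::complex_vector) \<Rightarrow> 'a tensor \<Rightarrow> 'b tensor"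
  where "tensor_map L = tensor_lift (\<lambda>xs. pure_tensor (map L xs))"

lemma multilinear_map:
  assumes "clinear L"
  shows "multilinear (\<lambda>xs. pure_tensor (map L xs))"
  by (simp add: multilinear_def clinear_add[OF assms] clinear_scale[OF assms]
      multilinearD[OF multilinear_pure_tensor])

lemma tensor_map_pure:
  "clinear L \<Longrightarrow> tensor_map L (pure_tensor xs) = pure_tensor (map L xs)"
  by (simp add: tensor_map_def tensor_lift_pure multilinear_map)


section \<open>Symmetric tensors\<close>

text \<open>The action of a permutation \<open>\<pi>\<close> of \<open>{..<s}\<close> on the \<open>s\<close>-fold tensor power; the other
  degrees of the tensor algebra are irrelevant and sent to 0.\<close>

definition permute_tensor :: "nat \<Rightarrow> (nat \<Rightarrow> nat) \<Rightarrow> 'a::complex_vector tensor \<Rightarrow> 'a tensor"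
  where "permute_tensor s \<pi> =
    tensor_lift (\<lambda>xs. if length xs = s then pure_tensor (permute_list \<pi> xs) else 0)"

definition sym_tensors :: "nat \<Rightarrow> 'a::complex_vector tensor set"
  where "sym_tensors s =
    {t \<in> tensor_power s. \<forall>\<pi>. \<pi> permutes {..<s} \<longrightarrow> permute_tensor s \<pi> t = t}"

definition sym_monomial :: "'a::complex_vector list \<Rightarrow> 'a tensor"
  where "sym_monomial xs = (1 / fact (length xs)) *\<^sub>C
    (\<Sum>\<pi> | \<pi> permutes {..<length xs}. pure_tensor (permute_list \<pi> xs))"

lemma permute_list_update:
  assumes "\<pi> permutes {..<length zs}" "i < length zs"
  shows "permute_list \<pi> (zs[i := x]) = (permute_list \<pi> zs)[inv \<pi> i := x]"
proof (rule nth_equalityI)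
  fix j assume "j < length (permute_list \<pi> (zs[i := x]))"
  then have j: "j < length zs" by simp
  have "\<pi> j < length zs" using assms(1) j permutes_in_image by fastforce
  moreover have "inv \<pi> i = j \<longleftrightarrow> i = \<pi> j"
    using assms(1) by (metis permutes_inverses)
  ultimately show "permute_list \<pi> (zs[i := x]) ! j = (permute_list \<pi> zs)[inv \<pi> i := x] ! j"
    using assms j by (auto simp: permute_list_nth nth_list_update)
qed simp

lemma multilinear_permute:
  assumes "\<pi> permutes {..<s}"
  shows "multilinear (\<lambda>xs. if length xs = s
    then pure_tensor (permute_list \<pi> xs) else (0 :: 'a::complex_vector tensor))"
proof -
  have *: "\<exists>us vs. \<forall>z. permute_list \<pi> (xs @ z # ys) = us @ z # vs"
    if "length (xs @ 0 # ys) = s" for xs ys :: "'a list"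
  proof -
    let ?zs = "xs @ 0 # ys" and ?i = "inv \<pi> (length xs)"
    have p: "\<pi> permutes {..<length ?zs}" using assms that by simp
    have i: "length xs < length ?zs" by simp
    then have i': "?i < length (permute_list \<pi> ?zs)"
      using permutes_in_image[OF permutes_inv[OF p]] by simp
    have "permute_list \<pi> (xs @ z # ys)
        = take ?i (permute_list \<pi> ?zs) @ z # drop (Suc ?i) (permute_list \<pi> ?zs)" for z
    proof -
      have "xs @ z # ys = ?zs[length xs := z]" by simp
      then have "permute_list \<pi> (xs @ z # ys) = (permute_list \<pi> ?zs)[?i := z]"
        using permute_list_update[OF p i] by metis
      then show ?thesis using upd_conv_take_nth_drop[OF i'] by simp
    qed
    then show ?thesis by blast
  qed
  show ?thesis
    unfolding multilinear_def
  proof (intro conjI allI)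
    fix xs ys :: "'a list" and x y and c :: complex
    show "(if length (xs @ (x + y) # ys) = s then pure_tensor (permute_list \<pi> (xs @ (x + y) # ys)) else 0)
      = (if length (xs @ x # ys) = s then pure_tensor (permute_list \<pi> (xs @ x # ys)) else 0)
      + (if length (xs @ y # ys) = s then pure_tensor (permute_list \<pi> (xs @ y # ys)) else 0)"
    proof (cases "length (xs @ 0 # ys) = s")
      case True
      with *[of xs ys] obtain us vs where "\<And>z. permute_list \<pi> (xs @ z # ys) = us @ z # vs"
        by blast
      with True show ?thesis by (simp add: multilinearD[OF multilinear_pure_tensor])
    qed simp
    show "(if length (xs @ (c *\<^sub>C x) # ys) = s then pure_tensor (permute_list \<pi> (xs @ (c *\<^sub>C x) # ys)) else 0)
      = c *\<^sub>C (if length (xs @ x # ys) = s then pure_tensor (permute_list \<pi> (xs @ x # ys)) else 0)"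
    proof (cases "length (xs @ 0 # ys) = s")
      case True
      with *[of xs ys] obtain us vs where "\<And>z. permute_list \<pi> (xs @ z # ys) = us @ z # vs"
        by blast
      with True show ?thesis by (simp add: multilinearD[OF multilinear_pure_tensor])
    qed simp
  qed
qed

lemma permute_tensor_pure:
  assumes "\<pi> permutes {..<length xs}"
  shows "permute_tensor (length xs) \<pi> (pure_tensor xs) = pure_tensor (permute_list \<pi> xs)"
  by (simp add: permute_tensor_def tensor_lift_pure multilinear_permute[OF assms])

lemma sym_monomial_in_sym_tensors: "sym_monomial xs \<in> sym_tensors (length xs)"
proof -
  let ?P = "{\<pi>. \<pi> permutes {..<length xs}}"
  have 1: "sym_monomial xs \<in> tensor_power (length xs)"
    unfolding sym_monomial_def tensor_power_def
    by (intro cvs.span_scale cvs.span_sum cvs.span_base) auto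
  have 2: "permute_tensor (length xs) \<rho> (sym_monomial xs) = sym_monomial xs"
    if r: "\<rho> permutes {..<length xs}" for \<rho>
  proof -
    note L = clinear_tensor_lift[OF multilinear_permute[OF r], folded permute_tensor_def]
    have "permute_tensor (length xs) \<rho> (pure_tensor (permute_list \<pi> xs))
        = pure_tensor (permute_list (\<pi> \<circ> \<rho>) xs)" for \<pi>
      using permute_tensor_pure[of \<rho> "permute_list \<pi> xs"] r permute_list_compose[OF r, of \<pi>]
      by simp
    then have "permute_tensor (length xs) \<rho> (sym_monomial xs) =
        (1 / fact (length xs)) *\<^sub>C (\<Sum>\<pi>\<in>?P. pure_tensor (permute_list (\<pi> \<circ> \<rho>) xs))"
      by (simp add: sym_monomial_def clinear_scale[OF L] clinear_sum[OF L])
    also have "(\<Sum>\<pi>\<in>?P. pure_tensor (permute_list (\<pi> \<circ> \<rho>) xs))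
        = (\<Sum>\<pi>\<in>?P. pure_tensor (permute_list \<pi> xs))"
      using sum_permutations_compose_right[OF r, of "\<lambda>\<pi>. pure_tensor (permute_list \<pi> xs)"]
      by simp
    finally show ?thesis by (simp add: sym_monomial_def)
  qed
  from 1 2 show ?thesis by (simp add: sym_tensors_def)
qed

lemma subspace_sym_tensors: "cvs.subspace (sym_tensors s :: 'a::complex_vector tensor set)"
proof -
  have L: "clinear (permute_tensor s \<pi> :: 'a tensor \<Rightarrow> _)" if "\<pi> permutes {..<s}" for \<pi>
    using clinear_tensor_lift[OF multilinear_permute[OF that]] by (simp add: permute_tensor_def)
  show ?thesis
    unfolding cvs.subspace_def sym_tensors_def tensor_power_def
    by (auto simp: clinear_zero[OF L] clinear_add[OF L] clinear_scale[OF L]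
        intro: cvs.span_zero cvs.span_add cvs.span_scale)
qed

theorem sym_tensors_eq_span:
  "sym_tensors s = cspan {sym_monomial xs | xs :: 'a::complex_vector list. length xs = s}"
proof
  show "cspan {sym_monomial xs | xs. length xs = s} \<subseteq> sym_tensors s"
    by (rule cvs.span_minimal[OF _ subspace_sym_tensors])
      (auto intro: sym_monomial_in_sym_tensors)
next
  let ?P = "{\<pi>. \<pi> permutes {..<s}}"
  let ?R = "\<lambda>t :: 'a tensor. (1 / fact s) *\<^sub>C (\<Sum>\<pi>\<in>?P. permute_tensor s \<pi> t)"
  have L: "clinear (permute_tensor s \<pi> :: 'a tensor \<Rightarrow> _)" if "\<pi> permutes {..<s}" for \<pi>
    using clinear_tensor_lift[OF multilinear_permute[OF that]] by (simp add: permute_tensor_def)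
  have R: "clinear ?R"
  proof (rule clinearI)
    fix x y :: "'a tensor" and c :: complex
    have "(\<Sum>\<pi>\<in>?P. permute_tensor s \<pi> (x + y))
        = (\<Sum>\<pi>\<in>?P. permute_tensor s \<pi> x + permute_tensor s \<pi> y)"
      by (rule sum.cong) (auto intro: clinear_add[OF L])
    then show "?R (x + y) = ?R x + ?R y"
      by (simp add: sum.distrib scaleC_add_right)
    have "(\<Sum>\<pi>\<in>?P. permute_tensor s \<pi> (c *\<^sub>C x)) = c *\<^sub>C (\<Sum>\<pi>\<in>?P. permute_tensor s \<pi> x)"
      unfolding cvs.scale_sum_right by (rule sum.cong) (auto intro: clinear_scale[OF L])
    then show "?R (c *\<^sub>C x) = c *\<^sub>C ?R x"
      by (simp add: scaleC_scaleC mult.commute)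
  qed
  have in_span: "?R t \<in> cspan {sym_monomial xs | xs. length xs = s}"
    if "t \<in> tensor_power s" for t :: "'a tensor"
    using that unfolding tensor_power_def
  proof (induct rule: cvs.span_induct_alt)
    case base
    show ?case unfolding clinear_zero[OF R] by (rule cvs.span_zero)
  next
    case (step c x y)
    from step(1) obtain xs where xs: "x = pure_tensor xs" "length xs = s" by blast
    have "?R x = sym_monomial xs"
      using xs by (auto simp: sym_monomial_def permute_tensor_pure)
    then have "?R x \<in> cspan {sym_monomial xs | xs. length xs = s}"
      using xs by (auto intro!: cvs.span_base)
    then show ?case
      unfolding clinear_add[OF R] clinear_scale[OF R]
      by (rule cvs.span_add[OF cvs.span_scale step(2)])
  qed
  show "sym_tensors s \<subseteq> cspan {sym_monomial xs | xs :: 'a list. length xs = s}"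
  proof
    fix t :: "'a tensor" assume t: "t \<in> sym_tensors s"
    then have "?R t = (1 / fact s) *\<^sub>C (\<Sum>\<pi>\<in>?P. t)"
      by (simp add: sym_tensors_def)
    also have "\<dots> = t"
      by (simp add: cvs.sum_constant_scale card_permutations del: sum_constant)
    finally have "?R t = t" .
    moreover have "t \<in> tensor_power s" using t by (simp add: sym_tensors_def)
    ultimately show "t \<in> cspan {sym_monomial xs | xs. length xs = s}"
      using in_span[of t] by (simp only:)
  qed
qed


section \<open>Holomorphic differentials on the unit disk\<close>

text \<open>A differential \<open>f(z) (dz)\<^sup>m\<close> is represented by its coefficient \<open>f\<close>, a function on the
  open unit disk extended by 0. So all the spaces \<open>H\<^sup>m(\<Delta>)\<close> have the same underlying
  vector space, and \<open>m\<close> only enters through the group action.\<close>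

typedef hol_disk =
  "{f :: complex \<Rightarrow> complex. f holomorphic_on ball 0 1 \<and> (\<forall>z. z \<notin> ball 0 1 \<longrightarrow> f z = 0)}"
  morphisms hol_apply Abs_hol_disk
  by (rule exI[of _ "\<lambda>_. 0"]) auto

setup_lifting type_definition_hol_disk

instantiation hol_disk :: "{complex_vector, comm_ring_1}"
begin

lift_definition zero_hol_disk :: hol_disk is "\<lambda>_. 0" by auto
lift_definition one_hol_disk :: hol_disk is "\<lambda>z. if z \<in> ball 0 1 then 1 else 0"
  by (auto intro: holomorphic_transform[OF holomorphic_on_const[of 1]])
lift_definition plus_hol_disk :: "hol_disk \<Rightarrow> hol_disk \<Rightarrow> hol_disk" is "\<lambda>f g z. f z + g z"
  by (auto intro: holomorphic_intros)
lift_definition uminus_hol_disk :: "hol_disk \<Rightarrow> hol_disk" is "\<lambda>f z. - f z"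
  by (auto intro: holomorphic_intros)
lift_definition minus_hol_disk :: "hol_disk \<Rightarrow> hol_disk \<Rightarrow> hol_disk" is "\<lambda>f g z. f z - g z"
  by (auto intro: holomorphic_intros)
lift_definition times_hol_disk :: "hol_disk \<Rightarrow> hol_disk \<Rightarrow> hol_disk" is "\<lambda>f g z. f z * g z"
  by (auto intro: holomorphic_intros)
lift_definition scaleC_hol_disk :: "complex \<Rightarrow> hol_disk \<Rightarrow> hol_disk" is "\<lambda>c f z. c * f z"
  by (auto intro: holomorphic_intros)

instance
proof
  show "(0::hol_disk) \<noteq> 1" by transfer (auto simp: fun_eq_iff intro!: exI[of _ 0])
qed (transfer; force simp: algebra_simps fun_eq_iff)+

end


section \<open>The action of \<open>PSU(1,1)\<close>\<close>

definition SU11 :: "(complex^2^2) set"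
  where "SU11 = {vector [vector [a, b], vector [cnj b, cnj a]] | a b.
    (cmod a)\<^sup>2 - (cmod b)\<^sup>2 = 1}"

definition psu11_rel :: "complex^2^2 \<Rightarrow> complex^2^2 \<Rightarrow> bool"
  where "psu11_rel A B \<longleftrightarrow> A \<in> SU11 \<and> B \<in> SU11 \<and> (A = B \<or> A = - B)"

lemma SU11_one: "mat 1 \<in> SU11"
proof -
  have "(mat 1 :: complex^2^2) = vector [vector [1, 0], vector [cnj 0, cnj 1]]"
    by (simp add: vec_eq_iff forall_2 mat_def)
  then show ?thesis
    unfolding SU11_def mem_Collect_eq by (intro exI[of _ 1] exI[of _ 0]) simp
qed

quotient_type psu11 = "complex^2^2" / partial: psu11_rel
proof (rule part_equivpI)
  show "\<exists>A. psu11_rel A A" using SU11_one by (auto simp: psu11_rel_def)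
  show "symp psu11_rel" by (auto simp: symp_def psu11_rel_def)
  show "transp psu11_rel" by (auto simp: transp_def psu11_rel_def)
qed

lemma SU11_D:
  assumes "A \<in> SU11"
  shows "(cmod (A$1$1))\<^sup>2 - (cmod (A$1$2))\<^sup>2 = 1"
  using assms by (auto simp: SU11_def)

lemma SU11_denominator:
  assumes "(cmod a)\<^sup>2 - (cmod b)\<^sup>2 = 1" "cmod z < 1"
  shows "cnj a - b * z \<noteq> 0"
proof
  assume "cnj a - b * z = 0"
  then have "cmod a = cmod b * cmod z" by (metis complex_mod_cnj eq_iff_diff_eq_0 norm_mult)
  also have "\<dots> \<le> cmod b" using assms(2) by (simp add: mult_left_le)
  finally have "(cmod a)\<^sup>2 \<le> (cmod b)\<^sup>2" by (simp add: power_mono)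
  then show False using assms(1) by linarith
qed

lemma SU11_moebius_in_disk:
  assumes ab: "(cmod a)\<^sup>2 - (cmod b)\<^sup>2 = 1" and z: "cmod z < 1"
  shows "cmod ((- cnj b + a * z) / (cnj a - b * z)) < 1"
proof -
  have "complex_of_real ((cmod (cnj a - b * z))\<^sup>2 - (cmod (- cnj b + a * z))\<^sup>2)
      = of_real (((cmod a)\<^sup>2 - (cmod b)\<^sup>2) * (1 - (cmod z)\<^sup>2))"
    unfolding of_real_diff of_real_mult of_real_1 complex_norm_square by (simp add: algebra_simps)
  then have "(cmod (cnj a - b * z))\<^sup>2 - (cmod (- cnj b + a * z))\<^sup>2 = 1 - (cmod z)\<^sup>2"
    using ab by (simp only: of_real_eq_iff) simp
  moreover have "(cmod z)\<^sup>2 < 1" using z by (simp add: power_less_one_iff)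
  ultimately have "(cmod (- cnj b + a * z))\<^sup>2 < (cmod (cnj a - b * z))\<^sup>2" by linarith
  then have "cmod (- cnj b + a * z) < cmod (cnj a - b * z)" by (rule power_less_imp_less_base) simp
  then show ?thesis using SU11_denominator[OF ab z] by (simp add: norm_divide)
qed

lift_definition diff_action :: "int \<Rightarrow> psu11 \<Rightarrow> hol_disk \<Rightarrow> hol_disk"
  is "\<lambda>m A f z. let a = A$1$1; b = A$1$2 in
    if z \<in> ball 0 1
    then f ((- cnj b + a * z) / (cnj a - b * z)) * (cnj a - b * z) powi (- 2 * m)
    else 0"
proof -
  fix m :: int and A B :: "complex^2^2" and f :: "complex \<Rightarrow> complex"
  let ?F = "\<lambda>A z. let a = A$1$1; b = A$1$2 in
    if z \<in> ball 0 1
    then f ((- cnj b + a * z) / (cnj a - b * z)) * (cnj a - b * z) powi (- 2 * m)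
    else 0"
  assume AB: "psu11_rel A B"
    and f: "f holomorphic_on ball 0 1 \<and> (\<forall>z. z \<notin> ball 0 1 \<longrightarrow> f z = 0)"
  have "?F (- B) = ?F B"
  proof
    fix z
    have 1: "cnj ((- B)$1$1) - (- B)$1$2 * z = - (cnj (B$1$1) - B$1$2 * z)" by simp
    have 2: "- cnj ((- B)$1$2) + (- B)$1$1 * z = - (- cnj (B$1$2) + B$1$1 * z)" by simp
    have 3: "(- w) powi (- 2 * m) = w powi (- 2 * m)" for w :: complex
      by (simp add: power_int_minus_left)
    have 4: "(- w) / (- v) = w / v" for w v :: complex by simp
    show "?F (- B) z = ?F B z"
      unfolding Let_def 1 2 3 4 ..
  qed
  then have eq: "?F A = ?F B" using AB by (auto simp: psu11_rel_def)
  let ?a = "A$1$1" and ?b = "A$1$2"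
  have ab: "(cmod ?a)\<^sup>2 - (cmod ?b)\<^sup>2 = 1" using AB by (simp add: psu11_rel_def SU11_D)
  have nz: "cnj ?a - ?b * z \<noteq> 0" if "z \<in> ball 0 1" for z
    using SU11_denominator[OF ab, of z] that by simp
  have phi: "(\<lambda>z. (- cnj ?b + ?a * z) / (cnj ?a - ?b * z)) holomorphic_on ball 0 1"
    by (intro holomorphic_intros nz)
  have "(f \<circ> (\<lambda>z. (- cnj ?b + ?a * z) / (cnj ?a - ?b * z))) holomorphic_on ball 0 1"
    by (rule holomorphic_on_compose_gen[OF phi])
      (use f SU11_moebius_in_disk[OF ab] in auto)
  then have "(\<lambda>z. f ((- cnj ?b + ?a * z) / (cnj ?a - ?b * z)) *
      (cnj ?a - ?b * z) powi (- 2 * m)) holomorphic_on ball 0 1"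
    by (intro holomorphic_intros) (use nz in \<open>simp_all add: o_def\<close>)
  then have "?F A holomorphic_on ball 0 1"
    by (rule holomorphic_transform) (simp add: Let_def)
  then show "(?F A holomorphic_on ball 0 1 \<and> (\<forall>z. z \<notin> ball 0 1 \<longrightarrow> ?F A z = 0)) \<and> ?F A = ?F B"
    using eq by (simp add: Let_def)
qed

lemma clinear_diff_action: "clinear (diff_action m g)"
  by (rule clinearI; transfer) (auto simp: fun_eq_iff Let_def algebra_simps)

text \<open>The diagonal action on tensors of vector fields.\<close>

definition vf_tensor_action :: "psu11 \<Rightarrow> hol_disk tensor \<Rightarrow> hol_disk tensor"
  where "vf_tensor_action g = tensor_map (diff_action (- 1) g)"


section \<open>The projection onto \<open>H\<^bsup>-s\<^esup>(\<Delta>)\<close>\<close>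

text \<open>One map on the whole tensor algebra, induced by
  \<open>f\<^sub>1 \<otimes> \<dots> \<otimes> f\<^sub>s \<mapsto> f\<^sub>1 \<cdots> f\<^sub>s\<close>; the projection \<open>\<P>\<^sub>s\<close> is its restriction to \<open>sym_tensors s\<close>.\<close>

definition sym_proj :: "hol_disk tensor \<Rightarrow> hol_disk"
  where "sym_proj = tensor_lift prod_list"

lemma scaleC_mult_hol_disk:
  fixes f g :: hol_disk
  shows "(c *\<^sub>C f) * g = c *\<^sub>C (f * g)" "f * (c *\<^sub>C g) = c *\<^sub>C (f * g)"
  by (transfer; simp add: fun_eq_iff)+

lemma multilinear_prod_list: "multilinear (prod_list :: hol_disk list \<Rightarrow> hol_disk)"
  by (simp add: multilinear_def algebra_simps scaleC_mult_hol_disk)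

lemma clinear_sym_proj: "clinear sym_proj"
  unfolding sym_proj_def by (rule clinear_tensor_lift[OF multilinear_prod_list])

theorem sym_proj_sym_monomial: "sym_proj (sym_monomial fs) = prod_list fs"
proof -
  let ?P = "{\<pi>. \<pi> permutes {..<length fs}}"
  have "prod_list (permute_list \<pi> fs) = prod_list fs" if "\<pi> \<in> ?P" for \<pi>
    using that by (metis mem_Collect_eq mset_permute_list prod_mset_prod_list)
  then have "(\<Sum>\<pi>\<in>?P. sym_proj (pure_tensor (permute_list \<pi> fs))) = (\<Sum>\<pi>\<in>?P. prod_list fs)"
    by (simp add: sym_proj_def tensor_lift_pure[OF multilinear_prod_list])
  then show ?thesis
    by (simp add: sym_monomial_def clinear_scale[OF clinear_sym_proj] clinear_sum[OF clinear_sym_proj]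
        cvs.sum_constant_scale card_permutations del: sum_constant)
qed

end

theory Submission
  imports Defs
begin

text \<open>Let \<open>V\<close> be the three-dimensional invariant space of vector fields with coefficients
  \<open>1, z, z\<^sup>2\<close>. Elements of \<open>V \<otimes> H\<^bsup>-(s-1)\<^esup>(\<Delta>)\<close> are functions \<open>F(z, w)\<close> that are quadratic in
  \<open>z\<close>, and for \<open>s \<ge> 2\<close> the restriction of \<open>F\<close> to the diagonal, with values in
  \<open>H\<^bsup>-s\<^esup>(\<Delta>)\<close>, has the equivariant section
  \[ f \mapsto f(w) + \frac{1}{s} f'(w) (z - w) + \frac{1}{2s(2s-1)} f''(w) (z - w)^2. \]
  Iterating it lowers the weight to \<open>-1\<close> and gives an equivariant section with values in
  \<open>V \<otimes> \<cdots> \<otimes> V \<otimes> H\<^bsup>-1\<^esup>(\<Delta>)\<close>. Symmetrization is equivariant and does not change the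
  product of the tensor factors.\<close>

section \<open>Linear maps and their determination by pure tensors\<close>

lemma clinear_compose: "clinear f \<Longrightarrow> clinear g \<Longrightarrow> clinear (\<lambda>x. f (g x))"
  by (rule clinearI) (simp_all add: clinear_add clinear_scale)

lemma clinear_plus: "clinear f \<Longrightarrow> clinear g \<Longrightarrow> clinear (\<lambda>x. f x + g x)"
  by (rule clinearI) (simp_all add: clinear_add clinear_scale scaleC_add_right add_ac)

lemma clinear_minus: "clinear f \<Longrightarrow> clinear g \<Longrightarrow> clinear (\<lambda>x. f x - g x)"
  by (rule clinearI) (simp_all add: clinear_add clinear_scale cvs.scale_right_diff_distrib)

lemma clinear_id: "clinear (\<lambda>x. x)"
  by (rule clinearI) simp_all

lemma clinear_scaleC: "clinear (\<lambda>x. c *\<^sub>C x)"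
  by (rule clinearI) (simp_all add: scaleC_add_right cvs.scale_left_commute)

lemma abs_tensor_single: "abs_tensor (Poly_Mapping.single xs 1) = pure_tensor xs"
  by (simp add: pure_tensor.abs_eq)

lemma clinear_abs_tensor: "clinear abs_tensor"
  by (rule clinearI) (simp_all add: plus_tensor.abs_eq scaleC_tensor.abs_eq)

lemma poly_mapping_eq_sum_single:
  fixes u :: "'a \<Rightarrow>\<^sub>0 complex"
  shows "u = (\<Sum>k\<in>Poly_Mapping.keys u. Poly_Mapping.lookup u k *\<^sub>C Poly_Mapping.single k 1)"
  by (rule poly_mapping_eqI)
    (simp add: lookup_sum lookup_scaleC lookup_single scaleC_complex_def when_def in_keys_iff
      if_distrib[where f = "(*) _"] sum.delta cong: if_cong)

text \<open>Any representative is a finite combination of words, so replacing each word by its pure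
  tensor gives the tensor back. This expresses that pure tensors span.\<close>

lemma tensor_lift_pure_tensor: "tensor_lift pure_tensor t = t"
proof (induct t)
  case (1 u)
  have "abs_tensor u = (\<Sum>k\<in>Poly_Mapping.keys u. Poly_Mapping.lookup u k *\<^sub>C pure_tensor k)"
    using arg_cong[OF poly_mapping_eq_sum_single[of u], of abs_tensor]
    by (simp only: clinear_sum[OF clinear_abs_tensor] clinear_scale[OF clinear_abs_tensor]
        abs_tensor_single)
  also have "\<dots> = tensor_lift pure_tensor (abs_tensor u)"
    by (simp only: tensor_lift_abs[OF multilinear_pure_tensor] free_lift_def)
  finally show ?case ..
qed

text \<open>Since pure tensors span, every identity below between linear maps of tensors is checked
  on them alone.\<close>

lemma tensor_lift_unique:
  assumes "clinear F" "clinear G" "\<And>xs. F (pure_tensor xs) = G (pure_tensor xs)"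
  shows "F t = G t"
proof -
  have "F (tensor_lift pure_tensor t) = G (tensor_lift pure_tensor t)"
    by (simp add: tensor_lift_def free_lift_def clinear_sum[OF assms(1)] clinear_sum[OF assms(2)]
        clinear_scale[OF assms(1)] clinear_scale[OF assms(2)] assms(3))
  then show ?thesis by (simp add: tensor_lift_pure_tensor)
qed

lemma clinear_tensor_map: "clinear L \<Longrightarrow> clinear (tensor_map L)"
  unfolding tensor_map_def by (intro clinear_tensor_lift multilinear_map)

section \<open>Symmetrization\<close>

lemma multilinear_sym_monomial: "multilinear sym_monomial"
  unfolding multilinear_def
proof (intro conjI allI)
  fix xs ys :: "'a list" and x y :: 'a and c :: complex
  let ?s = "length (xs @ x # ys)"
  \<comment> \<open>All three words have length \<open>?s\<close>, so the conditional in
    \<open>multilinear_permute\<close> never takes its default value 0.\<close>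
  have M: "pure_tensor (permute_list \<pi> (xs @ (x + y) # ys))
        = pure_tensor (permute_list \<pi> (xs @ x # ys)) + pure_tensor (permute_list \<pi> (xs @ y # ys))"
      "pure_tensor (permute_list \<pi> (xs @ (c *\<^sub>C x) # ys))
        = c *\<^sub>C pure_tensor (permute_list \<pi> (xs @ x # ys))"
    if "\<pi> permutes {..<?s}" for \<pi>
    using multilinearD[OF multilinear_permute[OF that], where xs = xs and ys = ys] by simp_all
  show "sym_monomial (xs @ (x + y) # ys) = sym_monomial (xs @ x # ys) + sym_monomial (xs @ y # ys)"
    using M by (simp add: sym_monomial_def scaleC_add_right sum.distrib)
  show "sym_monomial (xs @ (c *\<^sub>C x) # ys) = c *\<^sub>C sym_monomial (xs @ x # ys)"
    using M by (simp add: sym_monomial_def cvs.scale_sum_right[symmetric] cvs.scale_left_commute)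
qed

text \<open>On words of length s this averages over all permutations. It acts on all degrees at
  once, hence takes no degree argument.\<close>

definition symmetrize :: "'a::complex_vector tensor \<Rightarrow> 'a tensor"
  where "symmetrize = tensor_lift sym_monomial"

lemma clinear_symmetrize: "clinear symmetrize"
  unfolding symmetrize_def by (rule clinear_tensor_lift[OF multilinear_sym_monomial])

lemma symmetrize_pure: "symmetrize (pure_tensor xs) = sym_monomial xs"
  by (simp add: symmetrize_def tensor_lift_pure multilinear_sym_monomial)

lemma symmetrize_in_sym_tensors:
  assumes "t \<in> tensor_power s"
  shows "symmetrize t \<in> sym_tensors s"
  using assms unfolding tensor_power_def
proof (induct rule: cvs.span_induct_alt)
  case base
  show ?case
    using cvs.subspace_0[OF subspace_sym_tensors] by (simp add: clinear_zero[OF clinear_symmetrize])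
next
  case (step c x y)
  then have "symmetrize x \<in> sym_tensors s"
    using sym_monomial_in_sym_tensors by (auto simp: symmetrize_pure)
  with step(2) show ?case
    by (simp add: clinear_add[OF clinear_symmetrize] clinear_scale[OF clinear_symmetrize]
        cvs.subspace_add cvs.subspace_scale subspace_sym_tensors)
qed

lemma tensor_map_sym_monomial:
  assumes "clinear L"
  shows "tensor_map L (sym_monomial xs) = sym_monomial (map L xs)"
  by (simp add: sym_monomial_def clinear_scale[OF clinear_tensor_map[OF assms]]
      clinear_sum[OF clinear_tensor_map[OF assms]] tensor_map_pure[OF assms] permute_list_map)

text \<open>Permuting factors commutes with applying one map to every factor. For \<open>L\<close> a
  group element this is the equivariance of symmetrization.\<close>

lemma symmetrize_tensor_map:
  assumes "clinear L"
  shows "symmetrize (tensor_map L t) = tensor_map L (symmetrize t)"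
  by (rule tensor_lift_unique[where F = "\<lambda>t. symmetrize (tensor_map L t)"])
    (simp_all add: clinear_compose clinear_symmetrize clinear_tensor_map assms
      tensor_map_pure symmetrize_pure tensor_map_sym_monomial)

lemma sym_proj_pure: "sym_proj (pure_tensor fs) = prod_list fs"
  by (simp add: sym_proj_def tensor_lift_pure multilinear_prod_list)

text \<open>Multiplication of functions is commutative, so averaging over the orders of the factors
  keeps their product. A section into nonsymmetric tensors may therefore be symmetrized
  afterwards.\<close>

lemma sym_proj_symmetrize: "sym_proj (symmetrize t) = sym_proj t"
  by (rule tensor_lift_unique[where F = "\<lambda>t. sym_proj (symmetrize t)"])
    (simp_all add: clinear_compose clinear_symmetrize clinear_sym_proj
      symmetrize_pure sym_proj_sym_monomial sym_proj_pure)

section \<open>Tensoring with a vector from the left\<close>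

definition tensor_cons :: "'a::complex_vector \<Rightarrow> 'a tensor \<Rightarrow> 'a tensor"
  where "tensor_cons x = tensor_lift (\<lambda>xs. pure_tensor (x # xs))"

lemma multilinear_pure_Cons: "multilinear (\<lambda>xs. pure_tensor (x # xs))"
  unfolding multilinear_def append_Cons[symmetric]
  by (simp only: multilinearD[OF multilinear_pure_tensor] simp_thms)

lemma clinear_tensor_cons: "clinear (tensor_cons x)"
  unfolding tensor_cons_def by (rule clinear_tensor_lift[OF multilinear_pure_Cons])

lemma tensor_cons_pure: "tensor_cons x (pure_tensor xs) = pure_tensor (x # xs)"
  by (simp add: tensor_cons_def tensor_lift_pure multilinear_pure_Cons)

lemma tensor_cons_add_left: "tensor_cons (x + y) t = tensor_cons x t + tensor_cons y t"
  by (rule tensor_lift_unique[where G = "\<lambda>t. tensor_cons x t + tensor_cons y t"])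
    (simp_all add: clinear_plus clinear_tensor_cons
      tensor_cons_pure multilinearD[OF multilinear_pure_tensor, of "[]", simplified])

lemma tensor_cons_scale_left: "tensor_cons (c *\<^sub>C x) t = tensor_cons x (c *\<^sub>C t)"
  by (rule tensor_lift_unique[where G = "\<lambda>t. tensor_cons x (c *\<^sub>C t)"])
    (simp_all add: clinear_compose clinear_scaleC clinear_tensor_cons
      tensor_cons_pure clinear_scale[OF clinear_tensor_cons]
        multilinearD[OF multilinear_pure_tensor, of "[]", simplified])

lemma tensor_cons_in_tensor_power:
  assumes "t \<in> tensor_power s"
  shows "tensor_cons x t \<in> tensor_power (Suc s)"
  using assms unfolding tensor_power_def
proof (induct rule: cvs.span_induct_alt)
  case base
  show ?case by (simp add: clinear_zero[OF clinear_tensor_cons] cvs.span_zero)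
next
  case (step c y z)
  then obtain xs where "y = pure_tensor xs" "length xs = s" by blast
  then have "tensor_cons x y \<in> cspan {pure_tensor xs |xs. length xs = Suc s}"
    by (intro cvs.span_base CollectI exI[of _ "x # xs"]) (simp add: tensor_cons_pure)
  with step(2) show ?case
    by (simp add: clinear_add[OF clinear_tensor_cons] clinear_scale[OF clinear_tensor_cons]
        cvs.span_add cvs.span_scale)
qed

lemma tensor_map_cons:
  assumes "clinear L"
  shows "tensor_map L (tensor_cons x t) = tensor_cons (L x) (tensor_map L t)"
  by (rule tensor_lift_unique[where F = "\<lambda>t. tensor_map L (tensor_cons x t)"])
    (simp_all add: clinear_compose clinear_tensor_cons clinear_tensor_map assms
      tensor_cons_pure tensor_map_pure[OF assms])

lemma clinear_mult_left: "clinear (\<lambda>g. f * g :: hol_disk)"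
  by (rule clinearI) (simp_all add: algebra_simps scaleC_mult_hol_disk)

lemma sym_proj_cons: "sym_proj (tensor_cons f t) = f * sym_proj t"
  by (rule tensor_lift_unique[where F = "\<lambda>t. sym_proj (tensor_cons f t)"])
    (simp_all add: clinear_compose clinear_tensor_cons clinear_sym_proj clinear_mult_left
      tensor_cons_pure sym_proj_pure)

section \<open>Coordinate and derivative on the disk\<close>

lemma hol_disk_eqI:
  assumes "\<And>z. cmod z < 1 \<Longrightarrow> hol_apply f z = hol_apply g z"
  shows "f = g"
proof -
  have "hol_apply f z = hol_apply g z" for z
    using assms[of z] hol_apply[of f] hol_apply[of g] by (cases "cmod z < 1") simp_all
  then show ?thesis by (simp add: hol_apply_inject[symmetric] fun_eq_iff)
qed

lift_definition hol_coord :: hol_disk is "\<lambda>z. if z \<in> ball 0 1 then z else 0"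
  by (auto intro: holomorphic_transform[OF holomorphic_on_ident])

text \<open>The cut-off is needed because the extension by 0 need not be differentiable on the unit
  circle.\<close>

lift_definition hol_deriv :: "hol_disk \<Rightarrow> hol_disk"
  is "\<lambda>f z. if z \<in> ball 0 1 then deriv f z else 0"
  by (auto intro: holomorphic_transform[OF holomorphic_deriv])

lemma hol_apply_simps:
  "hol_apply (f + g) z = hol_apply f z + hol_apply g z"
  "hol_apply (f - g) z = hol_apply f z - hol_apply g z"
  "hol_apply (f * g) z = hol_apply f z * hol_apply g z"
  "hol_apply (c *\<^sub>C f) z = c * hol_apply f z"
  "cmod z < 1 \<Longrightarrow> hol_apply 1 z = 1"
  "cmod z < 1 \<Longrightarrow> hol_apply hol_coord z = z"
  by (transfer; simp)+

lemma hol_deriv_DERIV: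
  "cmod z < 1 \<Longrightarrow> (hol_apply f has_field_derivative hol_apply (hol_deriv f) z) (at z)"
  by transfer (auto intro: holomorphic_derivI)

text \<open>Differentiation is local, so a formula \<open>F\<close> valid only inside the open disk
  suffices.\<close>

lemma hol_apply_hol_deriv_eq:
  assumes "cmod z < 1" "\<And>w. cmod w < 1 \<Longrightarrow> hol_apply f w = F w"
    and "(F has_field_derivative d) (at z)"
  shows "hol_apply (hol_deriv f) z = d"
proof -
  have "(hol_apply f has_field_derivative d) (at z)"
    by (rule has_field_derivative_transform_within_open[OF assms(3), of "ball 0 1"])
      (use assms(1,2) in auto)
  then show ?thesis using hol_deriv_DERIV[OF assms(1)] DERIV_unique by blast
qed

lemma clinear_hol_deriv: "clinear hol_deriv"
proof (rule clinearI)
  fix f g :: hol_disk and c :: complex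
  show "hol_deriv (f + g) = hol_deriv f + hol_deriv g"
    by (rule hol_disk_eqI, rule hol_apply_hol_deriv_eq[where F = "\<lambda>z. hol_apply f z + hol_apply g z"])
      (auto simp: hol_apply_simps intro!: DERIV_add hol_deriv_DERIV)
  show "hol_deriv (c *\<^sub>C f) = c *\<^sub>C hol_deriv f"
    by (rule hol_disk_eqI, rule hol_apply_hol_deriv_eq[where F = "\<lambda>z. c * hol_apply f z"])
      (auto simp: hol_apply_simps intro!: DERIV_cmult hol_deriv_DERIV)
qed

section \<open>The action in matrix entries and its effect on the jet coefficients\<close>

lemma psu11_cases:
  obtains a b where "(cmod a)\<^sup>2 - (cmod b)\<^sup>2 = 1"
    "\<And>m f z. cmod z < 1 \<Longrightarrow> hol_apply (diff_action m g f) z =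
      hol_apply f ((- cnj b + a * z) / (cnj a - b * z)) * (cnj a - b * z) powi (- 2 * m)"
proof -
  \<comment> \<open>Fixing one of the two matrices representing \<open>g\<close> yields a single
    pair a, b valid for all m, f and z.\<close>
  have "psu11_rel (rep_psu11 g) (rep_psu11 g)"
    by (rule Quotient_rep_reflp[OF Quotient_psu11])
  then have "rep_psu11 g \<in> SU11" by (simp add: psu11_rel_def)
  from SU11_D[OF this] show thesis
    by (rule that) (simp add: diff_action.rep_eq Let_def)
qed

text \<open>The equivariance of the section after cancelling common powers of the automorphy factor \<open>j\<close>:
  \<open>X, Z, V\<close> stand for \<open>f\<close>, \<open>f'/s\<close> and \<open>f''/(2s(2s-1))\<close> at the image point \<open>p/j\<close> of \<open>w\<close>, and \<open>A, B\<close> for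
  the conjugates of \<open>a, b\<close>.\<close>

lemma moebius_jet_identities:
  fixes a b A B w p j X Z V :: complex
  assumes "a * A - b * B = 1" "j = A - b * w" "p = - B + a * w"
  defines "q2 \<equiv> V - b * Z * j + b\<^sup>2 * X * j\<^sup>2"
  defines "q1 \<equiv> Z * j\<^sup>2 - 2 * b * X * j ^ 3 - 2 * w * q2"
  defines "d2 \<equiv> V * j\<^sup>2" 
  defines "d1 \<equiv> Z * j\<^sup>2 - 2 * p * j * V"
  defines "d0 \<equiv> X * j\<^sup>2 - p * j * Z + p\<^sup>2 * V"
  shows "q2 = b\<^sup>2 * d0 - a * b * d1 + a\<^sup>2 * d2"
    "q1 = - (2 * A * b) * d0 + (a * A + b * B) * d1 - 2 * a * B * d2"
    "X * j ^ 4 - w * q1 - w\<^sup>2 * q2 = A\<^sup>2 * d0 - A * B * d1 + B\<^sup>2 * d2"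
proof -
  \<comment> \<open>The inverse matrix, with rows (A, B) and (b, a), takes (p, j) back to (w,
    1).\<close>
  have w: "w = A * p + B * j" and 1: "a * j + b * p = 1" using assms(1-3) by algebra+
  show "q2 = b\<^sup>2 * d0 - a * b * d1 + a\<^sup>2 * d2"
    unfolding q2_def d0_def d1_def d2_def using 1 by algebra
  show "q1 = - (2 * A * b) * d0 + (a * A + b * B) * d1 - 2 * a * B * d2"
    unfolding q2_def q1_def d0_def d1_def d2_def using w 1 assms(1-3) by algebra
  show "X * j ^ 4 - w * q1 - w\<^sup>2 * q2 = A\<^sup>2 * d0 - A * B * d1 + B\<^sup>2 * d2"
    unfolding q2_def q1_def d0_def d1_def d2_def using w 1 assms(1-3) by algebra
qed

text \<open>\<open>jet0 n f\<close>, \<open>jet1 n f\<close>, \<open>jet2 n f\<close> are the coefficients of \<open>1, z, z\<^sup>2\<close> in the section above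
  for \<open>s = n + 2\<close>, as functions of \<open>w\<close>.\<close>

definition jet2 :: "nat \<Rightarrow> hol_disk \<Rightarrow> hol_disk"
  where "jet2 n f = (1 / of_nat ((2 * n + 4) * (2 * n + 3))) *\<^sub>C hol_deriv (hol_deriv f)"

definition jet1 :: "nat \<Rightarrow> hol_disk \<Rightarrow> hol_disk"
  where "jet1 n f = (1 / of_nat (n + 2)) *\<^sub>C hol_deriv f - hol_coord * (2 *\<^sub>C jet2 n f)"

definition jet0 :: "nat \<Rightarrow> hol_disk \<Rightarrow> hol_disk"
  where "jet0 n f = f - hol_coord * jet1 n f - hol_coord * (hol_coord * jet2 n f)"

lemma clinear_jet2: "clinear (jet2 n)"
  unfolding jet2_def
  by (intro clinear_compose[OF clinear_scaleC] clinear_compose[OF clinear_hol_deriv]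
      clinear_hol_deriv)

lemma clinear_jet1: "clinear (jet1 n)"
  unfolding jet1_def
  by (intro clinear_minus clinear_compose[OF clinear_scaleC] clinear_compose[OF clinear_mult_left]
      clinear_hol_deriv clinear_jet2)

lemma clinear_jet0: "clinear (jet0 n)"
  unfolding jet0_def
  by (intro clinear_minus clinear_compose[OF clinear_mult_left] clinear_id clinear_jet1 clinear_jet2)

text \<open>By determinant one the Moebius map has derivative 1/j^2 with j = A - b z, so the chain
  rule lowers the power of j by two; the other term comes from j' = -b. Writing the exponent as k +
  2 keeps all exponents natural.\<close>

lemma DERIV_moebius_weight:
  fixes a b A B z :: complex
  assumes "a * A - b * B = 1" "A - b * z \<noteq> 0" "cmod ((- B + a * z) / (A - b * z)) < 1"
  shows "((\<lambda>z. hol_apply f ((- B + a * z) / (A - b * z)) * (A - b * z) ^ (k + 2))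
    has_field_derivative
      hol_apply (hol_deriv f) ((- B + a * z) / (A - b * z)) * (A - b * z) ^ k
      - of_nat (k + 2) * b * hol_apply f ((- B + a * z) / (A - b * z)) * (A - b * z) ^ (k + 1)) (at z)"
proof -
  let ?j = "A - b * z"
  have "((\<lambda>z. (- B + a * z) / (A - b * z)) has_field_derivative
      (a * ?j - (- B + a * z) * (- b)) / (?j * ?j)) (at z)"
    using assms(2) by (auto intro!: derivative_eq_intros)
  moreover have "a * ?j - (- B + a * z) * (- b) = 1"
    using assms(1) by (simp add: algebra_simps)
  ultimately have phi: "((\<lambda>z. (- B + a * z) / (A - b * z)) has_field_derivative 1 / ?j\<^sup>2) (at z)"
    by (simp add: power2_eq_square)
  have j: "((\<lambda>z. (A - b * z) ^ (k + 2)) has_field_derivative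
      of_nat (k + 2) * (- b) * ?j ^ (k + 1)) (at z)"
    by (rule DERIV_cong[OF DERIV_power[where D = "- b"]])
      (auto intro!: derivative_eq_intros)
  have cancel: "1 / x\<^sup>2 * x ^ (k + 2) = x ^ k" if "x \<noteq> 0" for x :: complex
    using that by (simp add: power_add power2_eq_square)
  show ?thesis
    by (rule DERIV_cong[OF DERIV_mult[OF DERIV_chain2[OF hol_deriv_DERIV[OF assms(3)] phi] j]])
      (simp only: mult.assoc cancel[OF assms(2)], simp)
qed

text \<open>If M is the matrix of g on the basis 1, z, z^2 given by the first three identities, the
  last three say that the jets transform by the transpose of M. Hence the sum of the tensors of
  basis vectors with their jets is carried along by g. All six share one choice of a, b, A, B so
  that the coefficients match.\<close>

lemma jets_equivariant:
  obtains a b A B where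
    "diff_action (- 1) g 1 = A\<^sup>2 *\<^sub>C 1 + (- 2 * A * b) *\<^sub>C hol_coord
      + b\<^sup>2 *\<^sub>C (hol_coord * hol_coord)"
    "diff_action (- 1) g hol_coord = (- A * B) *\<^sub>C 1 + (a * A + b * B) *\<^sub>C hol_coord
      + (- a * b) *\<^sub>C (hol_coord * hol_coord)"
    "diff_action (- 1) g (hol_coord * hol_coord) = B\<^sup>2 *\<^sub>C 1 + (- 2 * a * B) *\<^sub>C hol_coord
      + a\<^sup>2 *\<^sub>C (hol_coord * hol_coord)"
    "\<And>n f. jet0 n (diff_action (- int (n + 2)) g f) =
      A\<^sup>2 *\<^sub>C diff_action (- int (n + 1)) g (jet0 n f)
      + (- A * B) *\<^sub>C diff_action (- int (n + 1)) g (jet1 n f)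
      + B\<^sup>2 *\<^sub>C diff_action (- int (n + 1)) g (jet2 n f)"
    "\<And>n f. jet1 n (diff_action (- int (n + 2)) g f) =
      (- 2 * A * b) *\<^sub>C diff_action (- int (n + 1)) g (jet0 n f)
      + (a * A + b * B) *\<^sub>C diff_action (- int (n + 1)) g (jet1 n f)
      + (- 2 * a * B) *\<^sub>C diff_action (- int (n + 1)) g (jet2 n f)"
    "\<And>n f. jet2 n (diff_action (- int (n + 2)) g f) =
      b\<^sup>2 *\<^sub>C diff_action (- int (n + 1)) g (jet0 n f)
      + (- a * b) *\<^sub>C diff_action (- int (n + 1)) g (jet1 n f)
      + a\<^sup>2 *\<^sub>C diff_action (- int (n + 1)) g (jet2 n f)"
proof -
  obtain a b where ab: "(cmod a)\<^sup>2 - (cmod b)\<^sup>2 = 1"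
    and act: "\<And>m f z. cmod z < 1 \<Longrightarrow> hol_apply (diff_action m g f) z =
      hol_apply f ((- cnj b + a * z) / (cnj a - b * z)) * (cnj a - b * z) powi (- 2 * m)"
    by (rule psu11_cases[of g]) blast
  define A B where "A = cnj a" and "B = cnj b"
  define j where "j z = A - b * z" for z
  define p where "p z = - B + a * z" for z
  define \<phi> where "\<phi> z = p z / j z" for z
  have "complex_of_real ((cmod a)\<^sup>2 - (cmod b)\<^sup>2) = a * A - b * B"
    unfolding A_def B_def of_real_diff complex_norm_square ..
  then have det: "a * A - b * B = 1" by (simp add: ab)
  have nz: "j z \<noteq> 0" if "cmod z < 1" for z
    using SU11_denominator[OF ab that] by (simp add: j_def A_def)
  have in_disk: "cmod (\<phi> z) < 1" if "cmod z < 1" for z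
    using SU11_moebius_in_disk[OF ab that] by (simp add: \<phi>_def p_def j_def A_def B_def)
  have act_pow: "hol_apply (diff_action (- int m) g f) z = hol_apply f (\<phi> z) * j z ^ (2 * m)"
    if "cmod z < 1" for m f z
    using act[OF that, of "- int m" f] power_int_of_nat[of "cnj a - b * z" "2 * m"]
    by (simp add: \<phi>_def p_def j_def A_def B_def)
  note act_vf = act_pow[of _ 1, simplified]
  have deriv: "((\<lambda>z. hol_apply f (\<phi> z) * j z ^ (k + 2)) has_field_derivative
      hol_apply (hol_deriv f) (\<phi> z) * j z ^ k
      - of_nat (k + 2) * b * hol_apply f (\<phi> z) * j z ^ (k + 1)) (at z)"
    if "cmod z < 1" for f k z
    using DERIV_moebius_weight[OF det] nz[OF that] in_disk[OF that]
    unfolding \<phi>_def p_def j_def by blast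
  have jets:
    "hol_apply (jet2 n (diff_action (- int (n + 2)) g f)) z =
      b\<^sup>2 * hol_apply (diff_action (- int (n + 1)) g (jet0 n f)) z
      - a * b * hol_apply (diff_action (- int (n + 1)) g (jet1 n f)) z
      + a\<^sup>2 * hol_apply (diff_action (- int (n + 1)) g (jet2 n f)) z" (is ?t2)
    "hol_apply (jet1 n (diff_action (- int (n + 2)) g f)) z =
      - (2 * A * b) * hol_apply (diff_action (- int (n + 1)) g (jet0 n f)) z
      + (a * A + b * B) * hol_apply (diff_action (- int (n + 1)) g (jet1 n f)) z
      - 2 * a * B * hol_apply (diff_action (- int (n + 1)) g (jet2 n f)) z" (is ?t1)
    "hol_apply (jet0 n (diff_action (- int (n + 2)) g f)) z =
      A\<^sup>2 * hol_apply (diff_action (- int (n + 1)) g (jet0 n f)) z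
      - A * B * hol_apply (diff_action (- int (n + 1)) g (jet1 n f)) z
      + B\<^sup>2 * hol_apply (diff_action (- int (n + 1)) g (jet2 n f)) z" (is ?t0)
    if z: "cmod z < 1" for n f z
  proof -
    let ?h = "diff_action (- int (n + 2)) g f"
    define X where "X = hol_apply f (\<phi> z)"
    define Z where "Z = hol_apply (hol_deriv f) (\<phi> z) / of_nat (n + 2)"
    define V where "V = hol_apply (jet2 n f) (\<phi> z)"
    \<comment> \<open>The action in weight -(n+2) contributes the power 2n + 4 of j, and two
      differentiations lower it to 2n at worst, so \<open>K\<close> is a common factor of all
      terms.\<close>
    define K where "K = j z ^ (2 * n)"
    define q2 where "q2 = V - b * Z * j z + b\<^sup>2 * X * (j z)\<^sup>2"
    define q1 where "q1 = Z * (j z)\<^sup>2 - 2 * b * X * j z ^ 3 - 2 * z * q2"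
    define d2 where "d2 = V * (j z)\<^sup>2"
    define d1 where "d1 = Z * (j z)\<^sup>2 - 2 * p z * j z * V"
    define d0 where "d0 = X * (j z)\<^sup>2 - p z * j z * Z + (p z)\<^sup>2 * V"
    have N: "of_nat (n + 2) \<noteq> (0::complex)" "of_nat (2 * n + 3) \<noteq> (0::complex)"
      by (simp_all only: of_nat_eq_0_iff)
    have N4: "of_nat (2 * n + 4) = (2 * of_nat (n + 2) :: complex)"
      by simp
    have Y: "hol_apply (hol_deriv f) (\<phi> z) = of_nat (n + 2) * Z"
      using N by (simp add: Z_def)
    have U: "hol_apply (hol_deriv (hol_deriv f)) (\<phi> z) = of_nat ((2 * n + 4) * (2 * n + 3)) * V"
      using N by (simp add: V_def jet2_def hol_apply_simps del: of_nat_add of_nat_mult)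
    have h1: "hol_apply (hol_deriv ?h) w =
        hol_apply (hol_deriv f) (\<phi> w) * j w ^ (2 * n + 2)
        - of_nat (2 * n + 4) * b * hol_apply f (\<phi> w) * j w ^ (2 * n + 3)" if w: "cmod w < 1" for w
      by (rule hol_apply_hol_deriv_eq[OF w act_pow DERIV_cong])
        (use deriv[OF w, of f "2 * n + 2"] in \<open>simp_all add: eval_nat_numeral\<close>)
    have h2: "hol_apply (hol_deriv (hol_deriv ?h)) z =
        (hol_apply (hol_deriv (hol_deriv f)) (\<phi> z) * K
          - of_nat (2 * n + 2) * b * hol_apply (hol_deriv f) (\<phi> z) * (K * j z))
        - of_nat (2 * n + 4) * b *
          (hol_apply (hol_deriv f) (\<phi> z) * (K * j z)
            - of_nat (2 * n + 3) * b * X * (K * (j z)\<^sup>2))"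
    proof (rule hol_apply_hol_deriv_eq[OF z h1])
      show "((\<lambda>w. hol_apply (hol_deriv f) (\<phi> w) * j w ^ (2 * n + 2)
          - of_nat (2 * n + 4) * b * hol_apply f (\<phi> w) * j w ^ (2 * n + 3))
        has_field_derivative
          (hol_apply (hol_deriv (hol_deriv f)) (\<phi> z) * K
            - of_nat (2 * n + 2) * b * hol_apply (hol_deriv f) (\<phi> z) * (K * j z))
          - of_nat (2 * n + 4) * b *
            (hol_apply (hol_deriv f) (\<phi> z) * (K * j z)
              - of_nat (2 * n + 3) * b * X * (K * (j z)\<^sup>2))) (at z)"
        using DERIV_diff[OF deriv[OF z, of "hol_deriv f" "2 * n"]
            DERIV_cmult[OF deriv[OF z, of f "2 * n + 1"], of "of_nat (2 * n + 4) * b"]]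
        by (simp add: K_def X_def mult_ac power_add power2_eq_square eval_nat_numeral
            del: of_nat_add of_nat_mult)
    qed
    have h0: "hol_apply ?h z = K * (X * j z ^ 4)"
      using act_pow[OF z, of "n + 2" f] by (simp add: K_def X_def power4_eq_xxxx mult_ac)
    have h1': "hol_apply (hol_deriv ?h) z
        = of_nat (n + 2) * K * (Z * (j z)\<^sup>2 - 2 * b * X * j z ^ 3)"
      unfolding h1[OF z] Y N4 X_def[symmetric] power_add K_def[symmetric] by algebra
    \<comment> \<open>The two coefficients of f' add up to 2(2n+3), and f' is (n+2)
      \<open>Z\<close>, so all three terms contain (2n+4)(2n+3). This explains the constant
      1/(2s(2s-1)) of the section; \<open>h1'\<close> likewise explains 1/s.\<close>
    have "hol_apply (hol_deriv (hol_deriv ?h)) z = of_nat ((2 * n + 4) * (2 * n + 3)) * (K * q2)"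
      unfolding h2 U Y q2_def of_nat_mult N4 by (simp add: algebra_simps power2_eq_square)
    then have j2: "hol_apply (jet2 n ?h) z = K * q2"
      using N by (simp add: jet2_def hol_apply_simps del: of_nat_add of_nat_mult)
    have j1: "hol_apply (jet1 n ?h) z = K * q1"
      unfolding jet1_def hol_apply_simps(1-4) hol_apply_simps(6)[OF z] h1' j2 q1_def
      using N by (simp add: right_diff_distrib mult_ac del: of_nat_add)
    have j0: "hol_apply (jet0 n ?h) z = K * (X * j z ^ 4 - z * q1 - z\<^sup>2 * q2)"
      unfolding jet0_def hol_apply_simps(1-4) hol_apply_simps(6)[OF z] h0 j1 j2 by algebra
    have g: "hol_apply (diff_action (- int (n + 1)) g u) z = hol_apply u (\<phi> z) * (K * (j z)\<^sup>2)" for u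
      using act_pow[OF z, of "n + 1" u] by (simp add: K_def power_add power2_eq_square mult_ac)
    have pj: "p z = \<phi> z * j z" using nz[OF z] by (simp add: \<phi>_def)
    have g2: "hol_apply (diff_action (- int (n + 1)) g (jet2 n f)) z = K * d2"
      unfolding g by (simp add: V_def d2_def)
    have f1: "hol_apply (jet1 n f) (\<phi> z) = Z - 2 * \<phi> z * V"
      using in_disk[OF z] by (simp add: jet1_def hol_apply_simps V_def Z_def)
    have f0: "hol_apply (jet0 n f) (\<phi> z) = X - \<phi> z * (Z - 2 * \<phi> z * V) - (\<phi> z)\<^sup>2 * V"
      using in_disk[OF z] by (simp add: jet0_def hol_apply_simps V_def[symmetric] X_def f1 power2_eq_square)
    have g1: "hol_apply (diff_action (- int (n + 1)) g (jet1 n f)) z = K * d1"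
      unfolding g f1 d1_def pj by algebra
    have g0: "hol_apply (diff_action (- int (n + 1)) g (jet0 n f)) z = K * d0"
      unfolding g f0 d0_def pj by algebra
    have I: "q2 = b\<^sup>2 * d0 - a * b * d1 + a\<^sup>2 * d2"
      "q1 = - (2 * A * b) * d0 + (a * A + b * B) * d1 - 2 * a * B * d2"
      "X * j z ^ 4 - z * q1 - z\<^sup>2 * q2 = A\<^sup>2 * d0 - A * B * d1 + B\<^sup>2 * d2"
      unfolding q1_def q2_def d0_def d1_def d2_def
      by (rule moebius_jet_identities[OF det j_def p_def])+
    show ?t2 unfolding j2 g0 g1 g2 I(1) by algebra
    show ?t1 unfolding j1 g0 g1 g2 I(2) by algebra
    show ?t0 unfolding j0 g0 g1 g2 I(3) by algebra
  qed
  show thesis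
  proof (rule that[of A b B a])
    show "diff_action (- 1) g 1 = A\<^sup>2 *\<^sub>C 1 + (- 2 * A * b) *\<^sub>C hol_coord
        + b\<^sup>2 *\<^sub>C (hol_coord * hol_coord)"
      by (rule hol_disk_eqI)
        (simp add: act_vf hol_apply_simps in_disk j_def power2_eq_square algebra_simps)
    show "diff_action (- 1) g hol_coord = (- A * B) *\<^sub>C 1 + (a * A + b * B) *\<^sub>C hol_coord
        + (- a * b) *\<^sub>C (hol_coord * hol_coord)"
    proof (rule hol_disk_eqI)
      fix z :: complex assume z: "cmod z < 1"
      \<comment> \<open>The factor j^2 of the action on vector fields clears the denominators of
        \<phi> and, below, of its square. Thus polynomials of degree at most 2 stay such.\<close>
      have "\<phi> z * (j z)\<^sup>2 = p z * j z"
        using nz[OF z] by (simp add: \<phi>_def power2_eq_square)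
      with z show "hol_apply (diff_action (- 1) g hol_coord) z =
          hol_apply ((- A * B) *\<^sub>C 1 + (a * A + b * B) *\<^sub>C hol_coord
            + (- a * b) *\<^sub>C (hol_coord * hol_coord)) z"
        by (simp add: act_vf hol_apply_simps in_disk p_def j_def algebra_simps)
    qed
    show "diff_action (- 1) g (hol_coord * hol_coord) = B\<^sup>2 *\<^sub>C 1
        + (- 2 * a * B) *\<^sub>C hol_coord + a\<^sup>2 *\<^sub>C (hol_coord * hol_coord)"
    proof (rule hol_disk_eqI)
      fix z :: complex assume z: "cmod z < 1"
      have "\<phi> z * \<phi> z * (j z)\<^sup>2 = (p z)\<^sup>2"
        using nz[OF z] by (simp add: \<phi>_def power2_eq_square)
      with z show "hol_apply (diff_action (- 1) g (hol_coord * hol_coord)) z =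
          hol_apply (B\<^sup>2 *\<^sub>C 1
            + (- 2 * a * B) *\<^sub>C hol_coord + a\<^sup>2 *\<^sub>C (hol_coord * hol_coord)) z"
        by (simp add: act_vf hol_apply_simps in_disk p_def power2_eq_square algebra_simps)
    qed
  qed (rule hol_disk_eqI, simp only: hol_apply_simps(1-4) jets, simp)+
qed

section \<open>Iterating the section\<close>

fun transvectant_section :: "nat \<Rightarrow> hol_disk \<Rightarrow> hol_disk tensor"
  where
    "transvectant_section 0 f = pure_tensor [f]"
  | "transvectant_section (Suc n) f =
      tensor_cons 1 (transvectant_section n (jet0 n f))
      + tensor_cons hol_coord (transvectant_section n (jet1 n f))
      + tensor_cons (hol_coord * hol_coord) (transvectant_section n (jet2 n f))"

lemma clinear_transvectant_section: "clinear (transvectant_section n)"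
proof (induct n)
  case 0
  show ?case
    by (rule clinearI) (simp_all add: multilinearD[OF multilinear_pure_tensor, of "[]", simplified])
next
  case (Suc n)
  then show ?case
    by (auto intro!: clinear_plus clinear_compose[OF clinear_tensor_cons] clinear_compose[OF Suc]
        clinear_jet0 clinear_jet1 clinear_jet2)
qed

text \<open>Each of the n steps splits off one quadratic factor, and the remaining vector field is
  the last factor, whence degree n + 1.\<close>

lemma transvectant_section_in_tensor_power: "transvectant_section n f \<in> tensor_power (Suc n)"
proof (induct n arbitrary: f)
  case 0
  show ?case unfolding tensor_power_def by (auto intro!: cvs.span_base exI[of _ "[f]"])
next
  case (Suc n)
  note tensor_cons_in_tensor_power[OF Suc]
  then show ?case unfolding tensor_power_def by (auto intro!: cvs.span_add)
qed

text \<open>\<open>jet0\<close> is defined so that jet0 + w jet1 + w^2 jet2 = f on the diagonal z =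
  w; every step therefore preserves the product.\<close>

lemma sym_proj_transvectant_section: "sym_proj (transvectant_section n f) = f"
proof (induct n arbitrary: f)
  case 0
  show ?case by (simp add: sym_proj_pure)
next
  case (Suc n)
  then show ?case
    by (simp add: clinear_add[OF clinear_sym_proj] sym_proj_cons jet0_def mult.assoc)
qed

lemma transvectant_section_equivariant:
  "transvectant_section n (diff_action (- int (n + 1)) g f) =
    vf_tensor_action g (transvectant_section n f)"
proof (induct n arbitrary: f)
  case 0
  show ?case by (simp add: vf_tensor_action_def tensor_map_pure[OF clinear_diff_action])
next
  case (Suc n)
  \<comment> \<open>Stage \<open>Suc n\<close> has weight -(n+2), on which the jets are taken; they
    land in weight -(n+1), where the induction hypothesis applies. After expansion the nine terms on
    each side agree up to order.\<close>
  have S: "- int (Suc n + 1) = - int (n + 2)" by simp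
  show ?case
    unfolding S
    by (rule jets_equivariant[of g])
      (simp only: transvectant_section.simps vf_tensor_action_def clinear_add[OF clinear_tensor_map[OF clinear_diff_action]]
        tensor_map_cons[OF clinear_diff_action] Suc[symmetric, unfolded vf_tensor_action_def]
        tensor_cons_add_left tensor_cons_scale_left clinear_add[OF clinear_tensor_cons]
        clinear_scale[OF clinear_tensor_cons]
        clinear_add[OF clinear_transvectant_section] clinear_scale[OF clinear_transvectant_section]
        add_ac)
qed

theorem proposition4p2:
  fixes s :: nat
  assumes "s \<ge> 1"
  shows "\<exists>\<sigma> :: hol_disk \<Rightarrow> hol_disk tensor.
    clinear \<sigma> \<and>
    (\<forall>f. \<sigma> f \<in> sym_tensors s) \<and>
    (\<forall>g f. \<sigma> (diff_action (- int s) g f) = vf_tensor_action g (\<sigma> f)) \<and>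
    (\<forall>f. sym_proj (\<sigma> f) = f)"
proof -
  \<comment> \<open>An s-fold tensor needs s - 1 splittings; for s = 1 there is none.\<close>
  obtain n where s: "s = Suc n" using assms by (cases s) auto
  let ?\<sigma> = "\<lambda>f. symmetrize (transvectant_section n f)"
  have "clinear ?\<sigma>"
    by (intro clinear_compose[OF clinear_symmetrize] clinear_transvectant_section)
  moreover have "?\<sigma> f \<in> sym_tensors s" for f
    unfolding s by (intro symmetrize_in_sym_tensors transvectant_section_in_tensor_power)
  moreover have "?\<sigma> (diff_action (- int s) g f) = vf_tensor_action g (?\<sigma> f)" for g f
    using transvectant_section_equivariant[of n g f]
    by (simp add: s vf_tensor_action_def symmetrize_tensor_map[OF clinear_diff_action])
  moreover have "sym_proj (?\<sigma> f) = f" for f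
    by (simp add: sym_proj_symmetrize sym_proj_transvectant_section)
  ultimately show ?thesis by (intro exI[of _ ?\<sigma>]) blast
qed

end
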